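(* Let $1<p_1\le p_2<\infty$ and $1<q<\infty$, and let $a,b$ be weight functions on $\mathbb R^n$. Then the continuous embedding $$W(L_a^{p_2)}(\mathbb R^n),L_b^{q)}(\mathbb R^n))\hookrightarrow W(L_a^{p_1)}(\mathbb R^n),L_b^{q)}(\mathbb R^n))$$ holds.
   Context: A weight function on $\mathbb R^n$ is a measurable, locally integrable real-valued function that is positive (it may vanish only on a set of measure zero). For $1<p<\infty$ and a weight $a$, the generalized grand Lebesgue space $L_a^{p)}(\mathbb R^n)$ consists of the (classes of) measurable $f$ with $$\|f\|_{L_a^{p)}(\mathbb R^n)}=\sup_{0<\varepsilon\le p-1}\varepsilon\left(\int_{\mathbb R^n}|f(x)|^{p-\varepsilon}a(x)^{\varepsilon/p}\,dx\right)^{1/(p-\varepsilon)}<\infty .$$ Fix a compact set $Q\subset\mathbb R^n$ with nonempty interior. For $1<p,q<\infty$ and weights $a,b$, the generalized grand Wiener amalgam space $W(L_a^{p)}(\mathbb R^n),L_b^{q)}(\mathbb R^n))$ consists of all (classes of) measurable $f:\mathbb R^n\to\mathbb C$ such that $f\chi_K\in L_a^{p)}(\mathbb R^n)$ for every compact $K\subset\mathbb R^n$ and such that the control function $x\mapsto\|f\chi_{Q+x}\|_{L_a^{p)}(\mathbb R^n)}$ belongs to $L_b^{q)}(\mathbb R^n)$. Its norm is $\|f\|=\big\|\,\|f\chi_{Q+x}\|_{L_a^{p)}(\mathbb R^n)}\,\big\|_{L_b^{q)}(\mathbb R^n)}$ (outer norm in the variable $x$). The symbol $\hookrightarrow$ denotes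 continuous inclusion. *)

theory Defs
  imports "HOL-Analysis.Analysis"
begin

definition weight :: "('a::euclidean_space \<Rightarrow> real) \<Rightarrow> bool" where
  "weight a \<longleftrightarrow> a \<in> borel_measurable lebesgue \<and>
     (\<forall>K. compact K \<longrightarrow> set_integrable lebesgue K a) \<and>
     (\<forall>x. 0 \<le> a x) \<and> (AE x in lebesgue. 0 < a x)"

text \<open>Powers with a positive real exponent on the extended nonnegative reals.\<close>

definition ennreal_powr :: "ennreal \<Rightarrow> real \<Rightarrow> ennreal" where
  "ennreal_powr u s = (if u = \<infinity> then \<infinity> else ennreal (enn2real u powr s))"

text \<open>
  Function spaces are sets of functions rather than of almost-everywhere classes: all norms and
  membership conditions below depend only on the class of the function.  Norms take values in
  the extended nonnegative reals, so that they make sense for every function.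
\<close>

definition grand_norm ::
  "real \<Rightarrow> ('a::euclidean_space \<Rightarrow> real) \<Rightarrow> ('a \<Rightarrow> 'b::real_normed_vector) \<Rightarrow> ennreal" where
  "grand_norm p a f =
     (SUP \<epsilon>\<in>{0<..p - 1}.
        ennreal \<epsilon> *
        ennreal_powr
          (\<integral>\<^sup>+ x. ennreal (norm (f x) powr (p - \<epsilon>) * a x powr (\<epsilon> / p)) \<partial>lebesgue)
          (1 / (p - \<epsilon>)))"

definition grand_Lebesgue ::
  "real \<Rightarrow> ('a::euclidean_space \<Rightarrow> real) \<Rightarrow> ('a \<Rightarrow> 'b::real_normed_vector) set" where
  "grand_Lebesgue p a = {f \<in> borel_measurable lebesgue. grand_norm p a f < \<infinity>}"

definition restr :: "'a set \<Rightarrow> ('a \<Rightarrow> 'b::real_vector) \<Rightarrow> 'a \<Rightarrow> 'b" where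
  "restr S f = (\<lambda>x. indicator S x *\<^sub>R f x)"

text \<open>
  The control function is real valued.  The conversion \<^const>\<open>enn2real\<close> sends \<open>\<infinity>\<close> to \<open>0\<close>,
  but for the members of the amalgam space the converted norm is finite, since every
  translate of the compact set \<open>Q\<close> is compact.
\<close>

definition control ::
  "'a::euclidean_space set \<Rightarrow> real \<Rightarrow> ('a \<Rightarrow> real) \<Rightarrow> ('a \<Rightarrow> complex) \<Rightarrow> 'a \<Rightarrow> real" where
  "control Q p a f = (\<lambda>x. enn2real (grand_norm p a (restr ((\<lambda>y. y + x) ` Q) f)))"

definition amalgam ::
  "'a::euclidean_space set \<Rightarrow> real \<Rightarrow> ('a \<Rightarrow> real) \<Rightarrow> real \<Rightarrow> ('a \<Rightarrow> real) \<Rightarrow> ('a \<Rightarrow> complex) set" where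
  "amalgam Q p a q b =
     {f \<in> borel_measurable lebesgue.
        (\<forall>K. compact K \<longrightarrow> restr K f \<in> grand_Lebesgue p a) \<and>
        control Q p a f \<in> grand_Lebesgue q b}"

definition amalgam_norm ::
  "'a::euclidean_space set \<Rightarrow> real \<Rightarrow> ('a \<Rightarrow> real) \<Rightarrow> real \<Rightarrow> ('a \<Rightarrow> real) \<Rightarrow> ('a \<Rightarrow> complex) \<Rightarrow> ennreal" where
  "amalgam_norm Q p a q b f = grand_norm q b (control Q p a f)"

text \<open>
  \<open>X\<close> is contained in \<open>Y\<close>, and the inclusion map is continuous for the distances
  \<open>NX (g - f)\<close> and \<open>NY (g - f)\<close>.
\<close>

definition continuous_inclusion ::
  "('a \<Rightarrow> 'b::real_vector) set \<Rightarrow> (('a \<Rightarrow> 'b) \<Rightarrow> ennreal) \<Rightarrow>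
   ('a \<Rightarrow> 'b) set \<Rightarrow> (('a \<Rightarrow> 'b) \<Rightarrow> ennreal) \<Rightarrow> bool" where
  "continuous_inclusion X NX Y NY \<longleftrightarrow> X \<subseteq> Y \<and>
     (\<forall>f\<in>X. \<forall>e::real. e > 0 \<longrightarrow> (\<exists>d::real. d > 0 \<and>
        (\<forall>g\<in>X. NX (\<lambda>x. g x - f x) < ennreal d \<longrightarrow> NY (\<lambda>x. g x - f x) < ennreal e)))"

text \<open>For linear spaces this is the usual norm estimate.\<close>

lemma continuous_inclusion_iff_bounded:
  assumes zero: "(\<lambda>x. 0) \<in> X"
    and scale: "\<And>c f. f \<in> X \<Longrightarrow> (\<lambda>x. c *\<^sub>R f x) \<in> X"
    and diff: "\<And>f g. f \<in> X \<Longrightarrow> g \<in> X \<Longrightarrow> (\<lambda>x. g x - f x) \<in> X"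
    and homX: "\<And>c f. f \<in> X \<Longrightarrow> NX (\<lambda>x. c *\<^sub>R f x) = ennreal \<bar>c\<bar> * NX f"
    and homY: "\<And>c f. f \<in> X \<Longrightarrow> NY (\<lambda>x. c *\<^sub>R f x) = ennreal \<bar>c\<bar> * NY f"
    and finX: "\<And>f. f \<in> X \<Longrightarrow> NX f < \<infinity>"
    and finY: "\<And>f. f \<in> Y \<Longrightarrow> NY f < \<infinity>"
  shows "continuous_inclusion X NX Y NY \<longleftrightarrow>
    X \<subseteq> Y \<and> (\<exists>C::real. C > 0 \<and> (\<forall>f\<in>X. NY f \<le> ennreal C * NX f))"
proof (intro iffI conjI)
  assume L: "continuous_inclusion X NX Y NY"
  then show sub: "X \<subseteq> Y" unfolding continuous_inclusion_def by (rule conjunct1)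
  have "\<exists>d::real. d > 0 \<and>
      (\<forall>g\<in>X. NX (\<lambda>x. g x - 0) < ennreal d \<longrightarrow> NY (\<lambda>x. g x - 0) < ennreal 1)"
    using L[unfolded continuous_inclusion_def, THEN conjunct2, rule_format, OF zero zero_less_one]
    by blast
  then obtain d :: real where d: "d > 0"
    and D: "\<And>g. g \<in> X \<Longrightarrow> NX g < ennreal d \<Longrightarrow> NY g < ennreal 1"
    by auto
  have "NY f \<le> ennreal (2 / d) * NX f" if f: "f \<in> X" for f
  proof -
    obtain N where N: "N \<ge> 0" "NX f = ennreal N"
      using finX[OF f] by (cases "NX f") auto
    obtain M where M: "M \<ge> 0" "NY f = ennreal M"
      using finY[of f] f sub by (cases "NY f") auto
    have key: "r * M < 1" if "r > 0" "r * N < d" for r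
    proof -
      have "NY (\<lambda>x. r *\<^sub>R f x) < ennreal 1"
      proof (rule D)
        show "NX (\<lambda>x. r *\<^sub>R f x) < ennreal d"
          unfolding homX[OF f] N(2) ennreal_mult[OF abs_ge_zero N(1), symmetric]
          using that d by (intro ennreal_lessI) auto
      qed (rule scale[OF f])
      then have "ennreal (\<bar>r\<bar> * M) < ennreal 1"
        unfolding homY[OF f] M(2) ennreal_mult[OF abs_ge_zero M(1), symmetric] .
      then show ?thesis
        using that M(1) by (subst (asm) ennreal_less_iff) auto
    qed
    have "M \<le> 2 / d * N"
    proof (cases "N = 0")
      case True
      show ?thesis
      proof (rule ccontr)
        assume "\<not> M \<le> 2 / d * N"
        then have "M > 0" using True M by simp
        then show False using key[of "1 / M"] True d by simp
      qed
    next
      case False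
      then show ?thesis using key[of "d / (2 * N)"] N d by (simp add: field_simps)
    qed
    moreover have "0 \<le> 2 / d" using d by simp
    ultimately show ?thesis
      unfolding N(2) M(2) using ennreal_leI ennreal_mult[OF _ N(1)] by metis
  qed
  then show "\<exists>C::real. C > 0 \<and> (\<forall>f\<in>X. NY f \<le> ennreal C * NX f)"
    using d by (intro exI[of _ "2 / d"]) auto
next
  assume R: "X \<subseteq> Y \<and> (\<exists>C::real. C > 0 \<and> (\<forall>f\<in>X. NY f \<le> ennreal C * NX f))"
  then obtain C :: real where C: "C > 0" "\<And>f. f \<in> X \<Longrightarrow> NY f \<le> ennreal C * NX f" by auto
  have *: "NY (\<lambda>x. g x - f x) < ennreal e"
    if "f \<in> X" "g \<in> X" "e > 0" and lt: "NX (\<lambda>x. g x - f x) < ennreal (e / C)" for f g e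
  proof -
    have "ennreal C * NX (\<lambda>x. g x - f x) < ennreal C * ennreal (e / C)"
      using lt C(1) by (intro ennreal_mult_strict_left_mono) auto
    also have "\<dots> = ennreal e" using C(1) that(3) by (subst ennreal_mult[symmetric]) auto
    finally show ?thesis using C(2)[OF diff[OF that(1,2)]] by (rule le_less_trans[rotated])
  qed
  then show "continuous_inclusion X NX Y NY"
    unfolding continuous_inclusion_def
  proof (intro conjI ballI allI impI)
    fix f and e :: real assume "f \<in> X" "e > 0"
    then show "\<exists>d::real. d > 0 \<and>
        (\<forall>g\<in>X. NX (\<lambda>x. g x - f x) < ennreal d \<longrightarrow> NY (\<lambda>x. g x - f x) < ennreal e)"
      using C(1) * by (intro exI[of _ "e / C"]) simp
  qed (use R in simp)
qed

end

theory Submission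
  imports Defs
begin

text \<open>
  With \<open>r = p1 - \<epsilon>\<close>, the integrand \<open>|f| powr r * a powr (1 - r / p1)\<close> of the first norm is
  compared with that of the second one separately on \<open>{a \<ge> 1}\<close> and on \<open>{a < 1}\<close>.  On the former, keeping the exponent \<open>r\<close> only
  increases the power of \<open>a\<close>.  On the latter, the power of \<open>a\<close> is kept, the exponent \<open>r\<close>
  is raised to \<open>r p2 / p1\<close>, and the error is at most the measure of the support because \<open>a < 1\<close>.
  The comparison constant is therefore independent of \<open>a\<close> and depends on the support only
  through its measure, so it is the same for all translates of \<open>Q\<close>.

  The control function is measurable since, by Fatou's lemma, the supremum over \<open>\<epsilon>\<close> may be
  restricted to rational \<open>\<epsilon>\<close>, and for each \<open>\<epsilon>\<close> Tonelli's theorem applies.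
\<close>

section \<open>Norm bounds as integral bounds\<close>

definition grand_int ::
  "real \<Rightarrow> ('a::euclidean_space \<Rightarrow> real) \<Rightarrow> ('a \<Rightarrow> 'b::real_normed_vector) \<Rightarrow> real \<Rightarrow> ennreal" where
  "grand_int p a f \<epsilon> =
     (\<integral>\<^sup>+ x. ennreal (norm (f x) powr (p - \<epsilon>) * a x powr (\<epsilon> / p)) \<partial>lebesgue)"

text \<open>On finite values the powers with exponents \<open>s\<close> and \<open>1 / s\<close> are
  inverse increasing maps. For \<open>u = \<infinity>\<close> both sides fail, because
  \<open>e\<close> is positive and \<open>L\<close> is finite.\<close>

lemma ennreal_powr_le_iff:
  assumes "0 < e" "0 < s" "0 \<le> L"
  shows "ennreal e * ennreal_powr u (1 / s) \<le> ennreal L \<longleftrightarrow> u \<le> ennreal ((L / e) powr s)"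
proof (cases u)
  case (real i)
  have "e * i powr (1 / s) \<le> L \<longleftrightarrow> i powr (1 / s) \<le> L / e"
    using assms by (simp add: field_simps)
  also have "\<dots> \<longleftrightarrow> i \<le> (L / e) powr s"
  proof
    assume "i powr (1 / s) \<le> L / e"
    then have "(i powr (1 / s)) powr s \<le> (L / e) powr s"
      using assms by (intro powr_mono2) auto
    then show "i \<le> (L / e) powr s" using assms real by (simp add: powr_powr)
  next
    assume "i \<le> (L / e) powr s"
    then have "i powr (1 / s) \<le> ((L / e) powr s) powr (1 / s)"
      using assms real by (intro powr_mono2) auto
    then show "i powr (1 / s) \<le> L / e" using assms by (simp add: powr_powr)
  qed
  finally show ?thesis
    using assms real by (simp add: ennreal_powr_def flip: ennreal_mult)
next
  case top
  then show ?thesis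
    using assms by (simp add: ennreal_powr_def ennreal_mult_top top_unique)
qed

text \<open>Removes the root, so that estimates can be made on integrals, which are additive. On the
  range of \<epsilon> the exponent \<open>p - \<epsilon>\<close> is at least 1, hence the root is
  invertible.\<close>

lemma grand_norm_le_iff:
  assumes "0 \<le> L"
  shows "grand_norm p a f \<le> ennreal L \<longleftrightarrow>
    (\<forall>\<epsilon>\<in>{0<..p - 1}. grand_int p a f \<epsilon> \<le> ennreal ((L / \<epsilon>) powr (p - \<epsilon>)))"
  using assms unfolding grand_norm_def SUP_le_iff grand_int_def
  by (intro ball_cong refl ennreal_powr_le_iff) auto

section \<open>Scaling and differences\<close>

text \<open>The constant leaves the integral as \<open>C powr (p - \<epsilon>)\<close>, whose root
  is \<open>C\<close> for every \<epsilon>. This serves the outer norm, with two control functions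
  as \<open>u\<close> and \<open>v\<close>.\<close>

lemma grand_norm_mono_scaled:
  assumes "0 < C" and le: "\<And>x. norm (u x) \<le> C * norm (v x)"
    and [measurable]: "v \<in> borel_measurable lebesgue" "a \<in> borel_measurable lebesgue"
  shows "grand_norm p a u \<le> ennreal C * grand_norm p a v"
proof (cases "grand_norm p a v")
  case (real n)
  have "grand_norm p a u \<le> ennreal (C * n)"
  proof (subst grand_norm_le_iff, use assms(1) real(1) in simp, intro ballI)
    fix \<epsilon> assume e: "\<epsilon> \<in> {0<..p - 1}"
    have "grand_int p a u \<epsilon> \<le>
        (\<integral>\<^sup>+ x. ennreal (C powr (p - \<epsilon>)) * ennreal (norm (v x) powr (p - \<epsilon>) * a x powr (\<epsilon> / p)) \<partial>lebesgue)"
      unfolding grand_int_def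
    proof (rule nn_integral_mono)
      fix x
      have "norm (u x) powr (p - \<epsilon>) \<le> (C * norm (v x)) powr (p - \<epsilon>)"
        using e le by (intro powr_mono2) auto
      also have "\<dots> = C powr (p - \<epsilon>) * norm (v x) powr (p - \<epsilon>)"
        using \<open>0 < C\<close> by (simp add: powr_mult)
      finally show "ennreal (norm (u x) powr (p - \<epsilon>) * a x powr (\<epsilon> / p)) \<le>
          ennreal (C powr (p - \<epsilon>)) * ennreal (norm (v x) powr (p - \<epsilon>) * a x powr (\<epsilon> / p))"
        by (simp flip: ennreal_mult add: mult_right_mono mult.assoc[symmetric])
    qed
    also have "\<dots> = ennreal (C powr (p - \<epsilon>)) * grand_int p a v \<epsilon>"
      unfolding grand_int_def by (simp add: nn_integral_cmult)
    also have "\<dots> \<le> ennreal (C powr (p - \<epsilon>)) * ennreal ((n / \<epsilon>) powr (p - \<epsilon>))"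
      using real e grand_norm_le_iff[of n p a v] by (intro mult_left_mono) auto
    also have "\<dots> = ennreal ((C * n / \<epsilon>) powr (p - \<epsilon>))"
      using \<open>0 < C\<close> real e by (simp flip: ennreal_mult powr_mult)
    finally show "grand_int p a u \<epsilon> \<le> ennreal ((C * n / \<epsilon>) powr (p - \<epsilon>))" .
  qed
  then show ?thesis using real assms by (simp add: ennreal_mult)
next
  case top
  then show ?thesis using assms by (simp add: ennreal_mult_top)
qed

text \<open>
  Finiteness matters because \<^const>\<open>control\<close> would turn an infinite norm of a difference into \<open>0\<close>.
\<close>

lemma grand_norm_diff_finite:
  assumes [measurable]: "f \<in> borel_measurable lebesgue" "g \<in> borel_measurable lebesgue"
      "a \<in> borel_measurable lebesgue"
    and "grand_norm p a f < \<infinity>" "grand_norm p a g < \<infinity>"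
  shows "grand_norm p a (\<lambda>x. g x - f x) < \<infinity>"
proof -
  obtain m where m: "0 \<le> m" "grand_norm p a f = ennreal m"
    using assms by (cases "grand_norm p a f") auto
  obtain n where n: "0 \<le> n" "grand_norm p a g = ennreal n"
    using assms by (cases "grand_norm p a g") auto
  define L where "L = max m n"
  have L: "0 \<le> L" "m \<le> L" "n \<le> L" using m by (auto simp: L_def)
  \<comment> \<open>One factor 2 comes from bounding the difference by twice the maximum of the
    norms. The other absorbs the two resulting summands, as \<open>2 \<le> 2 powr s\<close> for
    \<open>s \<ge> 1\<close>.\<close>
  have "grand_norm p a (\<lambda>x. g x - f x) \<le> ennreal (4 * L)"
  proof (subst grand_norm_le_iff, use L in simp, intro ballI)
    fix \<epsilon> assume e: "\<epsilon> \<in> {0<..p - 1}"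
    define s where "s = p - \<epsilon>"
    have s: "1 \<le> s" using e by (auto simp: s_def)
    let ?w = "\<lambda>x. a x powr (\<epsilon> / p)"
    have pw: "norm (g x - f x) powr s * ?w x \<le>
        2 powr s * (norm (g x) powr s * ?w x) + 2 powr s * (norm (f x) powr s * ?w x)" for x
    proof -
      have "norm (g x - f x) \<le> 2 * max (norm (g x)) (norm (f x))"
        using norm_triangle_ineq4[of "g x" "f x"] by linarith
      then have "norm (g x - f x) powr s \<le> (2 * max (norm (g x)) (norm (f x))) powr s"
        using s by (intro powr_mono2) auto
      also have "\<dots> = 2 powr s * max (norm (g x)) (norm (f x)) powr s"
        by (simp add: powr_mult le_max_iff_disj)
      also have "\<dots> \<le> 2 powr s * (norm (g x) powr s + norm (f x) powr s)"
        by (intro mult_left_mono) (auto simp: max_def)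
      finally have "norm (g x - f x) powr s * ?w x
        \<le> 2 powr s * (norm (g x) powr s + norm (f x) powr s) * ?w x"
        by (rule mult_right_mono) auto
      then show ?thesis by (simp add: algebra_simps)
    qed
    have "grand_int p a (\<lambda>x. g x - f x) \<epsilon> \<le>
      (\<integral>\<^sup>+ x. ennreal (2 powr s) * ennreal (norm (g x) powr s * ?w x) +
           ennreal (2 powr s) * ennreal (norm (f x) powr s * ?w x) \<partial>lebesgue)"
      unfolding grand_int_def s_def[symmetric]
      by (intro nn_integral_mono)
        (use pw in \<open>simp flip: ennreal_mult ennreal_plus\<close>)
    also have "\<dots> = ennreal (2 powr s) * grand_int p a g \<epsilon> + ennreal (2 powr s) * grand_int p a f \<epsilon>"
      unfolding grand_int_def s_def[symmetric]
      by (simp add: nn_integral_add nn_integral_cmult)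
    also have "\<dots> \<le> ennreal (2 powr s) * ennreal ((L / \<epsilon>) powr s) + ennreal (2 powr s) * ennreal ((L / \<epsilon>) powr s)"
    proof -
      have "grand_norm p a f \<le> ennreal L" "grand_norm p a g \<le> ennreal L"
        using L m n by (auto intro: ennreal_leI)
      then have "grand_int p a f \<epsilon> \<le> ennreal ((L / \<epsilon>) powr s)" "grand_int p a g \<epsilon> \<le> ennreal ((L / \<epsilon>) powr s)"
        using e L by (auto simp: grand_norm_le_iff s_def)
      then show ?thesis by (intro add_mono mult_left_mono) auto
    qed
    also have "\<dots> = ennreal (2 * (2 * (L / \<epsilon>)) powr s)"
      unfolding powr_mult by (simp flip: ennreal_mult ennreal_plus)
    also have "\<dots> \<le> ennreal (2 powr s * (2 * (L / \<epsilon>)) powr s)"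
      using s powr_mono[of 1 s 2] by (intro ennreal_leI mult_right_mono) auto
    also have "\<dots> = ennreal ((4 * L / \<epsilon>) powr s)"
      using L e by (simp flip: powr_mult)
    finally show "grand_int p a (\<lambda>x. g x - f x) \<epsilon> \<le> ennreal ((4 * L / \<epsilon>) powr (p - \<epsilon>))"
      by (simp add: s_def)
  qed
  then show ?thesis by (rule le_less_trans) auto
qed

section \<open>Comparison of exponents on sets of finite measure\<close>

text \<open>Here \<open>t\<close> and \<open>w\<close> stand for \<open>norm (f x)\<close> and
  \<open>a x\<close>, and \<open>M\<close> is a free threshold. If \<open>w < 1\<close>, the weight
  power is at most 1, so \<open>t \<le> M\<close> costs at most \<open>M powr r\<close>. For
  \<open>t > M\<close> one has \<open>t powr (r - s) \<le> M powr (r - s)\<close>.\<close>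

lemma powr_split_bound:
  fixes t M w r s p1 p2 :: real
  assumes "0 \<le> t" "0 < M" "0 \<le> w" "0 < r" "r \<le> s" "r < p1" "p1 \<le> p2"
  shows "t powr r * w powr ((p1 - r) / p1) \<le>
    t powr r * w powr ((p2 - r) / p2) + (M powr (r - s) * (t powr s * w powr ((p1 - r) / p1)) + M powr r)"
proof (cases "1 \<le> w")
  case True
  \<comment> \<open>The exponent is \<open>1 - r / p\<close>, increasing in
    \<open>p\<close>.\<close>
  have "(p1 - r) / p1 \<le> (p2 - r) / p2"
    using assms by (simp add: divide_simps) (simp add: algebra_simps)
  then have "t powr r * w powr ((p1 - r) / p1) \<le> t powr r * w powr ((p2 - r) / p2)"
    using True by (intro mult_left_mono powr_mono) auto
  then show ?thesis by (smt (verit) mult_nonneg_nonneg powr_ge_zero)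
next
  case False
  define W where "W = w powr ((p1 - r) / p1)"
  have W: "0 \<le> W" "W \<le> 1" using False assms by (auto simp: W_def intro: powr_le1)
  have "t powr r * W \<le> M powr (r - s) * (t powr s * W) + M powr r"
  proof (cases "t \<le> M")
    case True
    then have "t powr r * W \<le> M powr r * 1"
      using assms W by (intro mult_mono powr_mono2) auto
    then show ?thesis using W by (smt (verit) mult_nonneg_nonneg powr_ge_zero)
  next
    case False
    then have "t powr (r - s) \<le> M powr (r - s)" using assms by (intro powr_mono2') auto
    then have "t powr (r - s) * t powr s \<le> M powr (r - s) * t powr s" by (rule mult_right_mono) auto
    then have "t powr r \<le> M powr (r - s) * t powr s"
      using False assms by (simp flip: powr_add)
    then have "t powr r * W \<le> M powr (r - s) * t powr s * W" by (rule mult_right_mono) (rule W)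
    then show ?thesis by (smt (verit) mult.assoc powr_ge_zero)
  qed
  then show ?thesis unfolding W_def by (smt (verit) mult_nonneg_nonneg powr_ge_zero)
qed

text \<open>With \<open>M = L / \<epsilon>\<close>, the three terms of
  \<open>powr_split_bound\<close> integrate over \<open>K\<close> to at most \<open>M powr r\<close>
  times 1, 1 and \<open>measure lebesgue K\<close>; their sum gives the constant.\<close>

lemma grand_norm_exponent_mono:
  assumes p: "1 < p1" "p1 \<le> p2"
    and [measurable]: "f \<in> borel_measurable lebesgue" "a \<in> borel_measurable lebesgue"
    and a: "\<And>x. 0 \<le> a x" and K: "K \<in> lmeasurable" and f0: "\<And>x. x \<notin> K \<Longrightarrow> f x = 0"
  shows "grand_norm p1 a f \<le> ennreal (2 + measure lebesgue K) * grand_norm p2 a f"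
proof (cases "grand_norm p2 a f")
  case (real n)
  define C where "C = 2 + measure lebesgue K"
  have C: "2 \<le> C" by (simp add: C_def)
  have KS[measurable]: "K \<in> sets lebesgue" using K by auto
  \<comment> \<open>\<open>L\<close> exceeds \<open>n\<close> in order to be positive also when \<open>n = 0\<close>.\<close>
  have main: "grand_norm p1 a f \<le> ennreal (C * L)" if L: "0 < L" "n \<le> L" for L
  proof (subst grand_norm_le_iff, use L C in simp, intro ballI)
    fix \<epsilon> assume e: "\<epsilon> \<in> {0<..p1 - 1}"
    define r where "r = p1 - \<epsilon>"
    \<comment> \<open>Chosen so that \<open>\<eta> / p2 = \<epsilon> / p1\<close>: the weight power
      is unchanged, while the exponent of the function rises from \<open>r\<close> to
      \<open>s = r * (p2 / p1)\<close>.\<close>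
    define \<eta> where "\<eta> = \<epsilon> * p2 / p1"
    define s where "s = p2 - \<eta>"
    define M where "M = L / \<epsilon>"
    have M: "0 < M" using L e by (simp add: M_def)
    have r: "1 \<le> r" "r < p1" using e by (auto simp: r_def)
    have "s = r * (p2 / p1)" using p by (simp add: s_def \<eta>_def r_def field_simps)
    moreover have "r * 1 \<le> r * (p2 / p1)" using p r by (intro mult_left_mono) auto
    ultimately have rs: "r \<le> s" by simp
    have \<eta>: "\<eta> \<in> {0<..p2 - 1}" using e p r rs by (auto simp: \<eta>_def s_def)
    have \<eta>e: "\<epsilon> \<le> \<eta>" using e p by (simp add: \<eta>_def field_simps)
    have \<eta>p: "\<eta> / p2 = (p1 - r) / p1" using p by (simp add: \<eta>_def r_def)
    \<comment> \<open>For \<open>\<delta> \<ge> \<epsilon>\<close> the quotient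
      \<open>L / \<delta>\<close> is at most \<open>M\<close>. This is used twice:
      \<open>\<delta> = p2 - r\<close> keeps the exponent \<open>r\<close>, and
      \<open>\<delta> = \<eta>\<close> gives \<open>s\<close>.\<close>
    have bd: "grand_int p2 a f \<delta> \<le> ennreal (M powr (p2 - \<delta>))" if "\<delta> \<in> {0<..p2 - 1}" "\<epsilon> \<le> \<delta>" for \<delta>
    proof -
      have "grand_norm p2 a f \<le> ennreal L" using real L by (auto intro: ennreal_leI)
      then have "grand_int p2 a f \<delta> \<le> ennreal ((L / \<delta>) powr (p2 - \<delta>))"
        using that L by (auto simp: grand_norm_le_iff)
      also have "\<dots> \<le> ennreal (M powr (p2 - \<delta>))"
        using that L e unfolding M_def by (intro ennreal_leI powr_mono2 divide_left_mono) auto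
      finally show ?thesis .
    qed
    have "grand_int p1 a f \<epsilon> \<le> (\<integral>\<^sup>+ x. ennreal (norm (f x) powr (p2 - (p2 - r)) * a x powr ((p2 - r) / p2)) +
        (ennreal (M powr (r - s)) * ennreal (norm (f x) powr (p2 - \<eta>) * a x powr (\<eta> / p2)) +
         ennreal (M powr r) * indicator K x) \<partial>lebesgue)"
      unfolding grand_int_def
    proof (rule nn_integral_mono)
      fix x
      show "ennreal (norm (f x) powr (p1 - \<epsilon>) * a x powr (\<epsilon> / p1)) \<le>
         ennreal (norm (f x) powr (p2 - (p2 - r)) * a x powr ((p2 - r) / p2)) +
        (ennreal (M powr (r - s)) * ennreal (norm (f x) powr (p2 - \<eta>) * a x powr (\<eta> / p2)) +
         ennreal (M powr r) * indicator K x)"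
      proof (cases "x \<in> K")
        case True
        have eqs: "p1 - \<epsilon> = r" "\<epsilon> / p1 = (p1 - r) / p1" "p2 - (p2 - r) = r" "p2 - \<eta> = s"
          by (auto simp: r_def s_def)
        have "norm (f x) powr r * a x powr ((p1 - r) / p1) \<le> norm (f x) powr r * a x powr ((p2 - r) / p2) +
           (M powr (r - s) * (norm (f x) powr s * a x powr ((p1 - r) / p1)) + M powr r)"
          using a M r rs p by (intro powr_split_bound) auto
        then show ?thesis
          using True unfolding \<eta>p eqs by (simp flip: ennreal_mult ennreal_plus)
      next
        case False
        then show ?thesis using f0 by simp
      qed
    qed
    also have "\<dots> = grand_int p2 a f (p2 - r) +
       (ennreal (M powr (r - s)) * grand_int p2 a f \<eta> + ennreal (M powr r) * emeasure lebesgue K)"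
      unfolding grand_int_def by (simp add: nn_integral_add nn_integral_cmult nn_integral_cmult_indicator)
    also have "\<dots> \<le> ennreal (M powr r) +
       (ennreal (M powr (r - s)) * ennreal (M powr s) + ennreal (M powr r) * ennreal (measure lebesgue K))"
    proof (intro add_mono mult_left_mono)
      show "grand_int p2 a f (p2 - r) \<le> ennreal (M powr r)"
        using bd[of "p2 - r"] r p by (simp add: r_def)
      show "grand_int p2 a f \<eta> \<le> ennreal (M powr s)"
        using bd[OF \<eta> \<eta>e] by (simp add: s_def)
      show "emeasure lebesgue K \<le> ennreal (measure lebesgue K)"
        using K by (simp only: emeasure_eq_measure2 order_refl)
    qed auto
    also have "\<dots> = ennreal (C * M powr r)"
    proof -
      have "M powr (r - s) * M powr s = M powr r" by (simp flip: powr_add)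
      then show ?thesis
        by (simp flip: ennreal_mult ennreal_plus add: C_def ring_distribs mult.commute)
    qed
    \<comment> \<open>Since \<open>C\<close> and \<open>r\<close> are at least 1, \<open>C\<close>
      may be replaced by \<open>C powr r\<close>, which the root turns back into
      \<open>C\<close>.\<close>
    also have "\<dots> \<le> ennreal (C powr r * M powr r)"
      using C r powr_mono[of 1 r C] by (intro ennreal_leI mult_right_mono) auto
    also have "\<dots> = ennreal ((C * L / \<epsilon>) powr (p1 - \<epsilon>))"
      using C M by (simp flip: powr_mult add: M_def r_def)
    finally show "grand_int p1 a f \<epsilon> \<le> ennreal ((C * L / \<epsilon>) powr (p1 - \<epsilon>))" .
  qed
  have "grand_norm p1 a f \<le> ennreal (C * n)"
  proof (rule ennreal_le_epsilon)
    fix e :: real assume e: "0 < e"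
    \<comment> \<open>The increment \<open>e / C\<close> makes the bound exactly
      \<open>C * n + e\<close>.\<close>
    have "grand_norm p1 a f \<le> ennreal (C * (n + e / C))"
      using e C real by (intro main) (auto intro: add_nonneg_pos)
    then show "grand_norm p1 a f \<le> ennreal (C * n) + ennreal e"
      using e C real by (simp add: distrib_left flip: ennreal_plus)
  qed
  then show ?thesis using real C by (simp add: ennreal_mult C_def)
next
  case top
  then show ?thesis by (simp add: ennreal_mult_top add_nonneg_eq_0_iff)
qed

section \<open>Measurability of the control function\<close>

text \<open>A countable supremum preserves measurability in a parameter. A bound valid at rational
  parameters passes to the others because the integrand is continuous in \<epsilon>.\<close>

lemma grand_norm_rational:
  assumes [measurable]: "f \<in> borel_measurable lebesgue" "a \<in> borel_measurable lebesgue"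
  shows "grand_norm p a f =
    (SUP \<epsilon>\<in>{0<..p - 1} \<inter> \<rat>. ennreal \<epsilon> * ennreal_powr (grand_int p a f \<epsilon>) (1 / (p - \<epsilon>)))"
    (is "_ = ?S")
proof (rule antisym)
  show "?S \<le> grand_norm p a f"
    unfolding grand_norm_def grand_int_def by (intro SUP_subset_mono) auto
  show "grand_norm p a f \<le> ?S"
  proof (cases ?S)
    case (real L)
    have "grand_norm p a f \<le> ennreal L"
    proof (subst grand_norm_le_iff, use real in simp, intro ballI)
      fix \<epsilon> assume e: "\<epsilon> \<in> {0<..p - 1}"
      \<comment> \<open>Approaching from below stays in the range even at
        \<open>\<epsilon> = p - 1\<close>; the maximum with 0 keeps the sequence positive.\<close>
      have "\<exists>\<delta>. \<delta> \<in> \<rat> \<and> max 0 (\<epsilon> - 1 / real (Suc n)) < \<delta> \<and> \<delta> < \<epsilon>" for n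
        using Rats_dense_in_real[of "max 0 (\<epsilon> - 1 / real (Suc n))" \<epsilon>] e by auto
      then obtain d where dQ: "\<And>n. d n \<in> \<rat>" and d1: "\<And>n. max 0 (\<epsilon> - 1 / real (Suc n)) < d n" and d2: "\<And>n. d n < \<epsilon>"
        by metis
      have d: "d n \<in> {0<..p - 1}" for n using d1[of n] d2[of n] e by auto
      have lim: "d \<longlonglongrightarrow> \<epsilon>"
      proof (rule tendsto_sandwich[OF _ _ _ tendsto_const])
        show "(\<lambda>n. \<epsilon> - 1 / real (Suc n)) \<longlonglongrightarrow> \<epsilon>"
          using tendsto_diff[OF tendsto_const LIMSEQ_inverse_real_of_nat] by (simp add: inverse_eq_divide)
      qed (use d1 d2 in \<open>auto simp: less_imp_le\<close>)
      let ?h = "\<lambda>\<delta> x. norm (f x) powr (p - \<delta>) * a x powr (\<delta> / p)"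
      have "grand_int p a f \<epsilon> = (\<integral>\<^sup>+ x. liminf (\<lambda>n. ennreal (?h (d n) x)) \<partial>lebesgue)"
        unfolding grand_int_def
      proof (rule nn_integral_cong)
        fix x
        \<comment> \<open>The limit rule for \<open>powr\<close> needs a nonzero base. A zero base
          has power 0 for every exponent, so there the sequence is constantly 0.\<close>
        have "(\<lambda>n. ?h (d n) x) \<longlonglongrightarrow> ?h \<epsilon> x"
        proof (cases "f x = 0 \<or> a x = 0")
          case False
          then show ?thesis using e by (intro tendsto_intros lim) auto
        qed auto
        then show "ennreal (?h \<epsilon> x) = liminf (\<lambda>n. ennreal (?h (d n) x))"
          by (intro lim_imp_Liminf[symmetric] tendsto_ennrealI) auto
      qed
      also have "\<dots> \<le> liminf (\<lambda>n. grand_int p a f (d n))"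
        unfolding grand_int_def by (rule nn_integral_liminf) measurable
      also have "\<dots> \<le> liminf (\<lambda>n. ennreal ((L / d n) powr (p - d n)))"
      proof (intro Liminf_mono always_eventually allI)
        fix n
        have "ennreal (d n) * ennreal_powr (grand_int p a f (d n)) (1 / (p - d n)) \<le> ?S"
          using d dQ by (intro SUP_upper) auto
        then show "grand_int p a f (d n) \<le> ennreal ((L / d n) powr (p - d n))"
          using d[of n] real by (subst (asm) real(2), subst (asm) ennreal_powr_le_iff) auto
      qed
      also have "\<dots> = ennreal ((L / \<epsilon>) powr (p - \<epsilon>))"
      proof -
        have "(\<lambda>n. (L / d n) powr (p - d n)) \<longlonglongrightarrow> (L / \<epsilon>) powr (p - \<epsilon>)"
        proof (cases "L = 0")
          case False
          then show ?thesis using e by (intro tendsto_intros lim) auto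
        qed auto
        then show ?thesis by (intro lim_imp_Liminf tendsto_ennrealI) auto
      qed
      finally show "grand_int p a f \<epsilon> \<le> ennreal ((L / \<epsilon>) powr (p - \<epsilon>))" .
    qed
    then show ?thesis using real by simp
  next
    case top
    show ?thesis unfolding top by simp
  qed
qed

text \<open>Tonelli's theorem needs joint measurability. A Borel function equal to \<open>G\<close>
  almost everywhere has the same integrals for every \<open>x\<close>, and the indicator of the
  translate is \<open>indicator Q (y - x)\<close>, Borel in the pair because \<open>Q\<close> is
  closed.\<close>

lemma borel_measurable_translate_integral:
  fixes Q :: "'a::euclidean_space set" and G :: "'a \<Rightarrow> ennreal"
  assumes Q: "closed Q" and G: "G \<in> borel_measurable lebesgue"
  shows "(\<lambda>x. \<integral>\<^sup>+ y. indicator ((\<lambda>y. y + x) ` Q) y * G y \<partial>lebesgue) \<in> borel_measurable lebesgue"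
proof -
  obtain G' where G'[measurable]: "G' \<in> borel_measurable lborel" and eq: "AE y in lborel. G y = G' y"
    using completion_ex_borel_measurable[OF G] by blast
  have [measurable]: "Q \<in> sets borel" using Q by auto
  have ind: "indicator ((\<lambda>y. y + x) ` Q) y = (indicator Q (y - x) :: ennreal)" for x y
    by (auto simp: indicator_def image_iff) (metis diff_add_cancel)
  have "(\<integral>\<^sup>+ y. indicator ((\<lambda>y. y + x) ` Q) y * G y \<partial>lebesgue) =
      (\<integral>\<^sup>+ y. indicator Q (y - x) * G' y \<partial>lborel)" for x
  proof -
    have "(\<integral>\<^sup>+ y. indicator ((\<lambda>y. y + x) ` Q) y * G y \<partial>lebesgue) =
      (\<integral>\<^sup>+ y. indicator Q (y - x) * G' y \<partial>lebesgue)"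
      unfolding ind using AE_completion[OF eq] by (intro nn_integral_cong_AE) auto
    also have "\<dots> = (\<integral>\<^sup>+ y. indicator Q (y - x) * G' y \<partial>lborel)"
      by (rule nn_integral_completion)
    finally show ?thesis .
  qed
  moreover have "(\<lambda>x. \<integral>\<^sup>+ y. indicator Q (y - x) * G' y \<partial>lborel) \<in> borel_measurable (lborel :: 'a measure)"
    by measurable
  ultimately show ?thesis by (simp add: measurable_completion)
qed

lemma borel_measurable_restr:
  fixes f :: "'a::euclidean_space \<Rightarrow> complex"
  assumes "K \<in> sets lebesgue" "f \<in> borel_measurable lebesgue"
  shows "restr K f \<in> borel_measurable lebesgue"
  using assms unfolding restr_def by measurable

lemma borel_measurable_ennreal_powr:
  assumes [measurable]: "u \<in> borel_measurable M"
  shows "(\<lambda>x. ennreal_powr (u x) s) \<in> borel_measurable M"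
  unfolding ennreal_powr_def by measurable

lemma compact_translate: "compact Q \<Longrightarrow> compact ((\<lambda>y. y + x) ` Q)" for x :: "'a::euclidean_space"
  by (intro compact_continuous_image continuous_intros)

lemma borel_measurable_control:
  assumes Q: "compact Q" and f[measurable]: "f \<in> borel_measurable lebesgue"
    and a[measurable]: "a \<in> borel_measurable lebesgue"
  shows "control Q p a f \<in> borel_measurable lebesgue"
proof -
  let ?T = "\<lambda>x. (\<lambda>y. y + x) ` Q"
  have rm: "restr (?T x) f \<in> borel_measurable lebesgue" for x
    using compact_translate[OF Q] by (intro borel_measurable_restr f fmeasurableD lmeasurable_compact)
  \<comment> \<open>The indicator leaves the power because a zero base has power 0.\<close>
  have int: "grand_int p a (restr (?T x) f) \<epsilon> =
    (\<integral>\<^sup>+ y. indicator (?T x) y * ennreal (norm (f y) powr (p - \<epsilon>) * a y powr (\<epsilon> / p)) \<partial>lebesgue)"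
    for x \<epsilon>
    unfolding grand_int_def restr_def
    by (intro nn_integral_cong) (auto simp: indicator_def)
  have "(\<lambda>x. grand_int p a (restr (?T x) f) \<epsilon>) \<in> borel_measurable lebesgue" for \<epsilon>
    unfolding int using Q by (intro borel_measurable_translate_integral compact_imp_closed) auto
  then have "(\<lambda>x. grand_norm p a (restr (?T x) f)) \<in> borel_measurable lebesgue"
    unfolding grand_norm_rational[OF rm a]
    by (intro borel_measurable_SUP borel_measurable_times_ennreal borel_measurable_ennreal_powr)
      (auto intro: countable_rat countable_subset)
  then show ?thesis unfolding control_def by measurable
qed

section \<open>Passage to the amalgam norms\<close>

text \<open>Translation invariance of the measure makes the factor the same for all
  \<open>x\<close>. Finiteness on translates of \<open>Q\<close> is what lets the inequality survive
  \<open>enn2real\<close>, which sends \<infinity> to 0.\<close>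

lemma control_exponent_mono:
  assumes Q: "compact Q" and p: "1 < p1" "p1 \<le> p2"
    and f: "f \<in> borel_measurable lebesgue" and a: "a \<in> borel_measurable lebesgue" "\<And>x. 0 \<le> a x"
    and fin: "\<And>K. compact K \<Longrightarrow> grand_norm p2 a (restr K f) < \<infinity>"
  shows "control Q p1 a f x \<le> (2 + measure lebesgue Q) * control Q p2 a f x"
proof -
  let ?T = "(\<lambda>y. y + x) ` Q"
  have T: "compact ?T" using Q by (rule compact_translate)
  have "measure lebesgue ?T = measure lebesgue Q"
    using measure_translation[of x Q] by (simp add: add.commute)
  moreover have "grand_norm p1 a (restr ?T f) \<le>
    ennreal (2 + measure lebesgue ?T) * grand_norm p2 a (restr ?T f)"
    using T f a p by (intro grand_norm_exponent_mono borel_measurable_restr)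
      (auto simp: restr_def lmeasurable_compact fmeasurableD)
  ultimately have "enn2real (grand_norm p1 a (restr ?T f)) \<le>
    enn2real (ennreal (2 + measure lebesgue Q) * grand_norm p2 a (restr ?T f))"
    using fin[OF T] by (intro enn2real_mono) (auto simp: ennreal_mult_less_top)
  then show ?thesis
    by (simp add: control_def enn2real_mult enn2real_ennreal del: ennreal_plus)
qed

theorem proposition3p3:
  fixes Q :: "(real ^ 'n) set" and a b :: "real ^ 'n \<Rightarrow> real" and p1 p2 q :: real
  assumes "compact Q" and "interior Q \<noteq> {}"
    and "1 < p1" and "p1 \<le> p2" and "1 < q"
    and "weight a" and "weight b"
  shows "continuous_inclusion
           (amalgam Q p2 a q b) (amalgam_norm Q p2 a q b)
           (amalgam Q p1 a q b) (amalgam_norm Q p1 a q b)"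
proof -
  define C where "C = 2 + measure lebesgue Q"
  have C: "0 < C" by (simp add: C_def add_pos_nonneg)
  have a: "a \<in> borel_measurable lebesgue" "\<And>x. 0 \<le> a x" using assms by (auto simp: weight_def)
  have rm: "restr K f \<in> borel_measurable lebesgue"
    if "compact K" "f \<in> borel_measurable lebesgue" for K and f :: "real ^ 'n \<Rightarrow> complex"
    using that by (intro borel_measurable_restr fmeasurableD lmeasurable_compact)
  \<comment> \<open>Formulated for locally finite norms rather than for members of the amalgam, so
    that it applies to \<open>g - f\<close> without first showing that the difference is a
    member.\<close>
  have norm_le: "amalgam_norm Q p1 a q b f \<le> ennreal C * amalgam_norm Q p2 a q b f"
    if "f \<in> borel_measurable lebesgue" "\<And>K. compact K \<Longrightarrow> grand_norm p2 a (restr K f) < \<infinity>" for f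
    unfolding amalgam_norm_def
  proof (rule grand_norm_mono_scaled[OF C])
    show "control Q p2 a f \<in> borel_measurable lebesgue" "b \<in> borel_measurable lebesgue"
      using borel_measurable_control[OF assms(1) that(1) a(1)] assms by (auto simp: weight_def)
    fix x
    show "norm (control Q p1 a f x) \<le> C * norm (control Q p2 a f x)"
      using control_exponent_mono[OF assms(1,3,4) that(1) a that(2), of x]
      by (simp add: C_def control_def)
  qed
  have meas: "f \<in> borel_measurable lebesgue"
    and fin: "\<And>K. compact K \<Longrightarrow> grand_norm p2 a (restr K f) < \<infinity>"
    and finN: "amalgam_norm Q p2 a q b f < \<infinity>"
    if "f \<in> amalgam Q p2 a q b" for f
    using that by (auto simp: amalgam_def grand_Lebesgue_def amalgam_norm_def)
  show ?thesis
    unfolding continuous_inclusion_def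
  proof (intro conjI subsetI ballI allI impI)
    fix f assume f: "f \<in> amalgam Q p2 a q b"
    \<comment> \<open>Only finiteness is required here, so the constant may depend on
      \<open>K\<close>.\<close>
    have "restr K f \<in> grand_Lebesgue p1 a" if K: "compact K" for K
    proof -
      have "grand_norm p1 a (restr K f) \<le> ennreal (2 + measure lebesgue K) * grand_norm p2 a (restr K f)"
        using K rm[OF K meas[OF f]] a assms(3,4)
        by (intro grand_norm_exponent_mono) (auto simp: restr_def lmeasurable_compact)
      also have "\<dots> < \<infinity>" using fin[OF f K] by (simp add: ennreal_mult_less_top)
      finally show ?thesis using rm[OF K meas[OF f]] by (simp add: grand_Lebesgue_def)
    qed
    moreover have "amalgam_norm Q p1 a q b f < \<infinity>"
      using norm_le[OF meas[OF f] fin[OF f]] finN[OF f]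
      by (auto simp: ennreal_mult_less_top intro: le_less_trans)
    ultimately show "f \<in> amalgam Q p1 a q b"
      using borel_measurable_control[OF assms(1) meas[OF f] a(1)] meas[OF f]
      by (simp add: amalgam_def grand_Lebesgue_def amalgam_norm_def)
  next
    fix f and e :: real assume f: "f \<in> amalgam Q p2 a q b" and e: "0 < e"
    have "amalgam_norm Q p1 a q b (\<lambda>x. g x - f x) < ennreal e"
      if g: "g \<in> amalgam Q p2 a q b" and lt: "amalgam_norm Q p2 a q b (\<lambda>x. g x - f x) < ennreal (e / C)" for g
    proof -
      have "grand_norm p2 a (restr K (\<lambda>x. g x - f x)) < \<infinity>" if K: "compact K" for K
        using grand_norm_diff_finite[OF rm[OF K meas[OF f]] rm[OF K meas[OF g]] a(1) fin[OF f K] fin[OF g K]]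
        by (simp add: restr_def scaleR_diff_right)
      then have "amalgam_norm Q p1 a q b (\<lambda>x. g x - f x) \<le> ennreal C * amalgam_norm Q p2 a q b (\<lambda>x. g x - f x)"
        using meas[OF f] meas[OF g] by (intro norm_le) auto
      also have "\<dots> < ennreal C * ennreal (e / C)"
        using lt C by (intro ennreal_mult_strict_left_mono) auto
      also have "\<dots> = ennreal e" using C e by (subst ennreal_mult[symmetric]) auto
      finally show ?thesis .
    qed
    then show "\<exists>d>0. \<forall>g\<in>amalgam Q p2 a q b. amalgam_norm Q p2 a q b (\<lambda>x. g x - f x) < ennreal d \<longrightarrow>
        amalgam_norm Q p1 a q b (\<lambda>x. g x - f x) < ennreal e"
      using e C by (intro exI[of _ "e / C"]) auto
  qed
qed

end
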